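(* Fix $n \in \mathbb{N}$, $n \ge 1$. For $r \in \mathbb{N}$ let $\sigma_r^2$ denote the optimal value of the semidefinite program $$\sigma_r^2 = \min \ \sum_{i=1}^n (1 - g_{e_i})$$ over real numbers $g_\alpha$ ($\alpha \in \mathbb{N}^n_r\setminus\{0\}$) and Hermitian positive semidefinite matrices $M$ with rows and columns indexed by $\mathbb{N}^n_r$, subject to the identity, for all $\boldsymbol\phi \in \mathbb{R}^n$, $$1 + \sum_{\alpha \in \mathbb{N}^n_r\setminus\{0\}} 2^{H(\alpha)} g_\alpha \prod_{i=1}^n \cos(\alpha_i\phi_i) = v_r(\boldsymbol\phi)^* M\, v_r(\boldsymbol\phi), \qquad v_r(\boldsymbol\phi) = \left[\exp(\imath\,\alpha^T\boldsymbol\phi)\right]_{\alpha\in\mathbb{N}^n_r}.$$ Then for all $r \ge n$, $$\sigma_r^2 \le n\left(1 - \cos\left(\frac{n\pi}{r+n}\right)\right),$$ and the right-hand side satisfies $$n\left(1 - \cos\left(\frac{n\pi}{r+n}\right)\right) \sim \frac{n^3\pi^2}{2(r+n)^2} \quad \text{as } r \to \infty,$$ i.e. the ratio of the two sides tends to $1$.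
   Context: $\mathbb{N}$ includes $0$ as a multi-index entry, and $\mathbb{N}^n_r = \{\alpha \in \mathbb{N}^n : \alpha_1+\dots+\alpha_n \le r\}$, a set of cardinality $\binom{n+r}{r}$. $e_i$ is the $i$-th canonical unit vector in $\mathbb{R}^n$. $H(\alpha)$ is the Hamming weight of $\alpha$, i.e. the number of its non-zero entries. $\imath$ is the imaginary unit and $^*$ denotes the conjugate transpose. Meaning of $\sigma_r$: a feasible solution of the program defines the kernel $K_r(\mathbf{x},\mathbf{y}) = 1 + \sum_{\alpha\in\mathbb{N}^n_r\setminus\{0\}} 2^{H(\alpha)} g_\alpha \prod_{i=1}^n T_{\alpha_i}(x_i)T_{\alpha_i}(y_i)$ on $[-1,1]^n\times[-1,1]^n$, where $T_k(x) = \cos(k\arccos x)$, and its objective value $\sum_{i=1}^n(1-g_{e_i})$ equals the squared resolution $\int\int \|\mathbf{x}-\mathbf{y}\|^2 K_r(\mathbf{x},\mathbf{y})\,\mathrm{d}\mu(\mathbf{x})\,\mathrm{d}\mu(\mathbf{y})$ with $\mathrm{d}\mu(\mathbf{x}) = \prod_{i=1}^n (\pi\sqrt{1-x_i^2})^{-1}\mathrm{d}\mathbf{x}$ on $[-1,1]^n$. *)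

theory Defs
  imports "HOL-Analysis.Analysis" "HOL-Library.Landau_Symbols"
begin

definition multi_indices :: "nat \<Rightarrow> (nat ^ 'n) set" where
  "multi_indices r = {\<alpha>. (\<Sum>i\<in>UNIV. \<alpha> $ i) \<le> r}"

definition hamming :: "nat ^ 'n \<Rightarrow> nat" where
  "hamming \<alpha> = card {i. \<alpha> $ i \<noteq> 0}"

text \<open>
  Vectors and matrices indexed by a finite set \<open>I\<close> are total functions, of which only the values
  on \<open>I\<close> matter: \<open>quad_form I M v\<close> is $v^* M v$ with sums over \<open>I\<close>.
\<close>

definition quad_form :: "'a set \<Rightarrow> ('a \<Rightarrow> 'a \<Rightarrow> complex) \<Rightarrow> ('a \<Rightarrow> complex) \<Rightarrow> complex" where
  "quad_form I M v = (\<Sum>\<alpha>\<in>I. \<Sum>\<beta>\<in>I. cnj (v \<alpha>) * M \<alpha> \<beta> * v \<beta>)"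

text \<open>For Hermitian \<open>M\<close> the quadratic form is real, so taking its real part loses nothing.\<close>

definition hermitian_psd :: "'a set \<Rightarrow> ('a \<Rightarrow> 'a \<Rightarrow> complex) \<Rightarrow> bool" where
  "hermitian_psd I M \<longleftrightarrow>
     (\<forall>\<alpha>\<in>I. \<forall>\<beta>\<in>I. M \<beta> \<alpha> = cnj (M \<alpha> \<beta>)) \<and> (\<forall>x. 0 \<le> Re (quad_form I M x))"

definition exp_vec :: "real ^ 'n \<Rightarrow> nat ^ 'n \<Rightarrow> complex" where
  "exp_vec \<phi> \<alpha> = exp (\<i> * complex_of_real (\<Sum>i\<in>UNIV. real (\<alpha> $ i) * \<phi> $ i))"

definition trig_kernel :: "nat \<Rightarrow> (nat ^ 'n \<Rightarrow> real) \<Rightarrow> real ^ 'n \<Rightarrow> real" where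
  "trig_kernel r g \<phi> =
     1 + (\<Sum>\<alpha>\<in>multi_indices r - {0}.
            2 ^ hamming \<alpha> * g \<alpha> * (\<Prod>i\<in>UNIV. cos (real (\<alpha> $ i) * \<phi> $ i)))"

definition feasible ::
  "nat \<Rightarrow> (nat ^ 'n \<Rightarrow> real) \<Rightarrow> (nat ^ 'n \<Rightarrow> nat ^ 'n \<Rightarrow> complex) \<Rightarrow> bool" where
  "feasible r g M \<longleftrightarrow>
     hermitian_psd (multi_indices r) M \<and>
     (\<forall>\<phi>. complex_of_real (trig_kernel r g \<phi>) = quad_form (multi_indices r) M (exp_vec \<phi>))"

definition objective :: "(nat ^ 'n \<Rightarrow> real) \<Rightarrow> real" where
  "objective g = (\<Sum>i\<in>UNIV. 1 - g (axis i 1))"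

text \<open>
  The optimal value, called $\sigma_r^2$. For \<open>r = 0\<close> the objective mentions coefficients that
  are not variables of the program, so the value is only meaningful for \<open>r \<ge> 1\<close>. In that case
  the infimum is attained; see \<open>sigma_sq_attained\<close> below.
\<close>

definition sigma_sq :: "'n::finite itself \<Rightarrow> nat \<Rightarrow> real" where
  "sigma_sq _ r = Inf {objective g | (g :: nat ^ 'n \<Rightarrow> real) M. feasible r g M}"


subsection \<open>The optimal value is a minimum\<close>

lemma finite_multi_indices [simp]: "finite (multi_indices r :: (nat ^ 'n::finite) set)"
proof -
  have "(multi_indices r :: (nat ^ 'n) set) \<subseteq> vec_lambda ` (PiE UNIV (\<lambda>_. {..r}))"
  proof
    fix \<alpha> :: "nat ^ 'n"
    assume "\<alpha> \<in> multi_indices r"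
    then have s: "(\<Sum>i\<in>UNIV. \<alpha> $ i) \<le> r"
      by (simp add: multi_indices_def)
    have "\<alpha> $ i \<le> r" for i
      using member_le_sum[of i UNIV "\<lambda>i. \<alpha> $ i"] s by simp
    then have "vec_nth \<alpha> \<in> PiE UNIV (\<lambda>_. {..r})"
      by auto
    then show "\<alpha> \<in> vec_lambda ` (PiE UNIV (\<lambda>_. {..r}))"
      by (metis image_eqI vec_nth_inverse)
  qed
  then show ?thesis
    by (rule finite_subset) (intro finite_imageI finite_PiE; simp)
qed

lemma multi_indices_le: "\<alpha> \<in> multi_indices r \<Longrightarrow> \<alpha> $ i \<le> r" for \<alpha> :: "nat ^ 'n::finite"
  using member_le_sum[of i UNIV "\<lambda>i. \<alpha> $ i"] by (simp add: multi_indices_def)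

lemma zero_in_multi_indices [simp]: "0 \<in> multi_indices r"
  by (simp add: multi_indices_def)

lemma axis_in_multi_indices:
  assumes "r \<ge> 1"
  shows "axis i 1 \<in> multi_indices r - {0 :: nat ^ 'n::finite}"
proof -
  have "(\<Sum>j\<in>UNIV. (axis i 1 :: nat ^ 'n) $ j) = (\<Sum>j\<in>UNIV. if j = i then 1 else 0)"
    by (intro sum.cong) (auto simp: axis_def)
  also have "\<dots> = 1"
    by simp
  finally have "(\<Sum>j\<in>UNIV. (axis i 1 :: nat ^ 'n) $ j) = 1" .
  moreover have "axis i 1 \<noteq> (0 :: nat ^ 'n)"
    by (metis axis_nth zero_index zero_neq_one)
  ultimately show ?thesis
    using assms by (simp add: multi_indices_def)
qed

lemma feasible_trivial:
  "feasible r (\<lambda>_. 0) (\<lambda>\<alpha> \<beta>. if \<alpha> = (0 :: nat ^ 'n::finite) \<and> \<beta> = 0 then 1 else 0)"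
proof -
  let ?I = "multi_indices r :: (nat ^ 'n) set"
  let ?M = "\<lambda>\<alpha> \<beta>. if \<alpha> = (0 :: nat ^ 'n) \<and> \<beta> = 0 then 1 else 0 :: complex"
  have q: "quad_form ?I ?M x = cnj (x 0) * x 0" for x
  proof -
    have "quad_form ?I ?M x = (\<Sum>\<alpha>\<in>?I. if \<alpha> = 0 then cnj (x 0) * x 0 else 0)"
      unfolding quad_form_def
    proof (rule sum.cong[OF refl])
      fix \<alpha> :: "nat ^ 'n"
      have "(\<Sum>\<beta>\<in>?I. cnj (x \<alpha>) * ?M \<alpha> \<beta> * x \<beta>)
          = (\<Sum>\<beta>\<in>?I. if \<beta> = 0 then (if \<alpha> = 0 then cnj (x 0) * x 0 else 0) else 0)"
        by (intro sum.cong) auto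
      then show "(\<Sum>\<beta>\<in>?I. cnj (x \<alpha>) * ?M \<alpha> \<beta> * x \<beta>)
          = (if \<alpha> = 0 then cnj (x 0) * x 0 else 0)"
        by simp
    qed
    then show ?thesis by simp
  qed
  show ?thesis
    by (auto simp: feasible_def hermitian_psd_def q trig_kernel_def exp_vec_def)
qed

subsubsection \<open>Averages over an equidistant grid\<close>

definition grid_pt :: "nat \<Rightarrow> ('n \<Rightarrow> nat) \<Rightarrow> real ^ 'n::finite" where
  "grid_pt r J = (\<chi> i. 2 * pi * real (J i) / real (2 * r + 1))"

definition grid :: "nat \<Rightarrow> ('n::finite \<Rightarrow> nat) set" where
  "grid r = PiE UNIV (\<lambda>_. {..<2 * r + 1})"

lemma finite_grid [simp]: "finite (grid r)"
  unfolding grid_def by (auto intro: finite_PiE)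

lemma card_grid: "card (grid r :: ('n::finite \<Rightarrow> nat) set) = (2 * r + 1) ^ CARD('n)"
  unfolding grid_def by (subst card_PiE) auto

lemma sum_grid_cis:
  fixes k :: int
  assumes "\<bar>k\<bar> \<le> 2 * int r"
  shows "(\<Sum>j<2*r+1. cis (real_of_int k * (2 * pi * real j / real (2 * r + 1))))
       = (if k = 0 then of_nat (2 * r + 1) else 0)"
proof (cases "k = 0")
  case False
  define N where "N = 2 * r + 1"
  have N: "N > 0" by (simp add: N_def)
  define z where "z = cis (real_of_int k * (2 * pi / real N))"
  have zN: "z ^ N = 1"
  proof -
    have "z ^ N = cis (2 * pi * real_of_int k)"
      using N by (simp add: z_def Complex.DeMoivre field_simps)
    then show ?thesis by (simp add: cis_multiple_2pi)
  qed
  have z1: "z \<noteq> 1"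
  proof
    assume "z = 1"
    then have "cos (real_of_int k * (2 * pi / real N)) = 1"
      by (metis z_def cis.sel(1) one_complex.sel(1))
    then obtain m :: int where "real_of_int k * (2 * pi / real N) = real_of_int m * 2 * pi"
      using cos_one_2pi_int by auto
    then have "real_of_int k = real_of_int m * real N"
      using N by (simp add: field_simps)
    then have km: "k = m * int N"
      by (metis of_int_eq_iff of_int_mult of_int_of_nat_eq)
    then have "m \<noteq> 0" using False by auto
    then have "\<bar>m\<bar> \<ge> 1" by simp
    then have "1 * int N \<le> \<bar>m\<bar> * int N" using N by (intro mult_right_mono) auto
    then have "int N \<le> \<bar>k\<bar>" by (simp add: km abs_mult)
    then show False using assms by (simp add: N_def)
  qed
  have "(\<Sum>j<N. cis (real_of_int k * (2 * pi * real j / real N))) = (\<Sum>j<N. z ^ j)"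
    by (intro sum.cong) (auto simp: z_def Complex.DeMoivre field_simps)
  also have "\<dots> = 0"
    using geometric_sum[OF z1, of N] zN by simp
  finally show ?thesis using False by (simp add: N_def)
qed auto

lemma sum_grid_cos:
  fixes k :: int
  assumes "\<bar>k\<bar> \<le> 2 * int r"
  shows "(\<Sum>j<2*r+1. cos (real_of_int k * (2 * pi * real j / real (2 * r + 1))))
       = (if k = 0 then real (2 * r + 1) else 0)"
  using arg_cong[OF sum_grid_cis[OF assms], of Re] by (auto simp: Re_sum)

lemma sum_grid_cos_cos:
  assumes "a \<le> r" "b \<le> r"
  shows "(\<Sum>j<2*r+1. cos (real a * (2 * pi * real j / real (2 * r + 1)))
                    * cos (real b * (2 * pi * real j / real (2 * r + 1))))
       = (if a = b then real (2 * r + 1) / (if a = 0 then 1 else 2) else 0)"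
proof -
  define \<theta> where "\<theta> j = 2 * pi * real j / real (2 * r + 1)" for j
  have 1: "(\<Sum>j<2*r+1. cos (real_of_int (int a - int b) * \<theta> j))
      = (if int a - int b = 0 then real (2 * r + 1) else 0)"
    unfolding \<theta>_def by (rule sum_grid_cos) (use assms in auto)
  have 2: "(\<Sum>j<2*r+1. cos (real_of_int (int a + int b) * \<theta> j))
      = (if int a + int b = 0 then real (2 * r + 1) else 0)"
    unfolding \<theta>_def by (rule sum_grid_cos) (use assms in auto)
  have "(\<Sum>j<2*r+1. cos (real a * \<theta> j) * cos (real b * \<theta> j))
      = (\<Sum>j<2*r+1. (cos (real_of_int (int a - int b) * \<theta> j)
                     + cos (real_of_int (int a + int b) * \<theta> j)) / 2)"
    by (intro sum.cong) (auto simp: cos_times_cos algebra_simps)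
  also have "\<dots> = ((if int a - int b = 0 then real (2 * r + 1) else 0)
                   + (if int a + int b = 0 then real (2 * r + 1) else 0)) / 2"
    by (simp only: sum_divide_distrib[symmetric] sum.distrib 1 2)
  also have "\<dots> = (if a = b then real (2 * r + 1) / (if a = 0 then 1 else 2) else 0)"
    using assms by auto
  finally show ?thesis by (simp add: \<theta>_def)
qed

lemma sum_grid_prod:
  fixes f :: "'n::finite \<Rightarrow> real \<Rightarrow> 'b::comm_semiring_1"
  shows "(\<Sum>J\<in>grid r. \<Prod>i\<in>UNIV. f i (grid_pt r J $ i))
       = (\<Prod>i\<in>UNIV. \<Sum>j<2*r+1. f i (2 * pi * real j / real (2 * r + 1)))"
  unfolding grid_def grid_pt_def by (subst prod_sum_PiE) auto

lemma sum_grid_exp_vec: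
  fixes \<alpha> \<beta> :: "nat ^ 'n::finite"
  assumes "\<alpha> \<in> multi_indices r" "\<beta> \<in> multi_indices r"
  shows "(\<Sum>J\<in>grid r. cnj (exp_vec (grid_pt r J) \<alpha>) * exp_vec (grid_pt r J) \<beta>)
       = (if \<alpha> = \<beta> then of_nat (card (grid r :: ('n \<Rightarrow> nat) set)) else 0)"
proof -
  have prod_cis: "(\<Prod>i\<in>UNIV. cis (h i)) = cis (\<Sum>i\<in>UNIV. h i)" for h :: "'n \<Rightarrow> real"
    by (simp add: cis_conv_exp exp_sum sum_distrib_left)
  have e: "cnj (exp_vec \<phi> \<alpha>) * exp_vec \<phi> \<beta>
      = (\<Prod>i\<in>UNIV. cis (real_of_int (int (\<beta> $ i) - int (\<alpha> $ i)) * \<phi> $ i))" for \<phi>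
    unfolding prod_cis exp_vec_def cis_conv_exp[symmetric] cis_cnj cis_mult
    by (simp add: left_diff_distrib sum_subtractf)
  have "(\<Sum>J\<in>grid r. cnj (exp_vec (grid_pt r J) \<alpha>) * exp_vec (grid_pt r J) \<beta>)
      = (\<Prod>i\<in>UNIV. \<Sum>j<2*r+1. cis (real_of_int (int (\<beta> $ i) - int (\<alpha> $ i))
            * (2 * pi * real j / real (2 * r + 1))))"
    unfolding e by (rule sum_grid_prod)
  also have "\<dots> = (\<Prod>i\<in>UNIV. if \<alpha> $ i = \<beta> $ i then of_nat (2 * r + 1) else 0)"
  proof (rule prod.cong[OF refl])
    fix i
    show "(\<Sum>j<2*r+1. cis (real_of_int (int (\<beta> $ i) - int (\<alpha> $ i))
            * (2 * pi * real j / real (2 * r + 1))))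
        = (if \<alpha> $ i = \<beta> $ i then of_nat (2 * r + 1) else 0)"
      using multi_indices_le[OF assms(1), of i] multi_indices_le[OF assms(2), of i]
      by (subst sum_grid_cis) auto
  qed
  also have "\<dots> = (if \<alpha> = \<beta> then of_nat (card (grid r :: ('n \<Rightarrow> nat) set)) else 0)"
    by (auto simp: card_grid vec_eq_iff)
  finally show ?thesis .
qed

lemma sum_grid_cos_prods:
  fixes \<alpha> \<beta> :: "nat ^ 'n::finite"
  assumes "\<alpha> \<in> multi_indices r" "\<beta> \<in> multi_indices r"
  shows "(\<Sum>J\<in>grid r. (\<Prod>i\<in>UNIV. cos (real (\<alpha> $ i) * grid_pt r J $ i))
                      * (\<Prod>i\<in>UNIV. cos (real (\<beta> $ i) * grid_pt r J $ i)))
       = (if \<alpha> = \<beta> then real (card (grid r :: ('n \<Rightarrow> nat) set)) / 2 ^ hamming \<alpha> else 0)"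
proof -
  have "(\<Sum>J\<in>grid r. (\<Prod>i\<in>UNIV. cos (real (\<alpha> $ i) * grid_pt r J $ i))
                     * (\<Prod>i\<in>UNIV. cos (real (\<beta> $ i) * grid_pt r J $ i)))
      = (\<Prod>i\<in>UNIV. \<Sum>j<2*r+1. cos (real (\<alpha> $ i) * (2 * pi * real j / real (2 * r + 1)))
            * cos (real (\<beta> $ i) * (2 * pi * real j / real (2 * r + 1))))"
    unfolding prod.distrib[symmetric] by (rule sum_grid_prod)
  also have "\<dots> = (\<Prod>i\<in>UNIV. if \<alpha> $ i = \<beta> $ i
      then real (2 * r + 1) / (if \<alpha> $ i = 0 then 1 else 2) else 0)"
    by (intro prod.cong sum_grid_cos_cos multi_indices_le assms refl)
  also have "\<dots> = (if \<alpha> = \<beta> then real (card (grid r :: ('n \<Rightarrow> nat) set)) / 2 ^ hamming \<alpha> else 0)"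
  proof (cases "\<alpha> = \<beta>")
    case True
    have "(\<Prod>i\<in>UNIV. (if \<alpha> $ i = 0 then 1 else 2) :: real) = 2 ^ hamming \<alpha>"
      by (simp add: prod.If_cases hamming_def Collect_neg_eq[symmetric])
    then show ?thesis
      using True by (simp add: prod_dividef card_grid)
  next
    case False
    then obtain k where "\<alpha> $ k \<noteq> \<beta> $ k" by (auto simp: vec_eq_iff)
    then have "\<exists>k\<in>UNIV. (if \<alpha> $ k = \<beta> $ k
        then real (2 * r + 1) / (if \<alpha> $ k = 0 then 1 else 2) else 0) = 0"
      by (intro bexI[of _ k]) auto
    then show ?thesis using False by (simp only: prod_zero[OF finite] if_False)
  qed
  finally show ?thesis .
qed

subsubsection \<open>Feasible points are bounded\<close>

lemma card_grid_pos: "card (grid r :: ('n::finite \<Rightarrow> nat) set) > 0"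
  by (simp add: card_grid)

lemma sum_grid_trig_kernel:
  fixes g :: "nat ^ 'n::finite \<Rightarrow> real"
  assumes "\<beta> \<in> multi_indices r"
  shows "(\<Sum>J\<in>grid r. trig_kernel r g (grid_pt r J)
                       * (\<Prod>i\<in>UNIV. cos (real (\<beta> $ i) * grid_pt r J $ i)))
       = real (card (grid r :: ('n \<Rightarrow> nat) set)) * (if \<beta> = 0 then 1 else g \<beta>)"
proof -
  define C where "C \<alpha> J = (\<Prod>i\<in>UNIV. cos (real (\<alpha> $ i) * grid_pt r J $ i))"
    for \<alpha> :: "nat ^ 'n" and J
  define c where "c = real (card (grid r :: ('n \<Rightarrow> nat) set))"
  have orth: "(\<Sum>J\<in>grid r. C \<alpha> J * C \<beta> J) = (if \<alpha> = \<beta> then c / 2 ^ hamming \<alpha> else 0)"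
    if "\<alpha> \<in> multi_indices r" for \<alpha>
    using sum_grid_cos_prods[OF that assms] by (simp add: C_def c_def)
  have C0: "C 0 J = 1" for J by (simp add: C_def)
  have h0: "hamming (0 :: nat ^ 'n) = 0" by (simp add: hamming_def)
  have "(\<Sum>J\<in>grid r. trig_kernel r g (grid_pt r J) * C \<beta> J)
      = (\<Sum>J\<in>grid r. C 0 J * C \<beta> J
          + (\<Sum>\<alpha>\<in>multi_indices r - {0}. 2 ^ hamming \<alpha> * g \<alpha> * (C \<alpha> J * C \<beta> J)))"
    by (simp add: trig_kernel_def C0 C_def[symmetric] distrib_right sum_distrib_right mult.assoc)
  also have "\<dots> = (\<Sum>J\<in>grid r. C 0 J * C \<beta> J)
      + (\<Sum>\<alpha>\<in>multi_indices r - {0}. 2 ^ hamming \<alpha> * g \<alpha> * (\<Sum>J\<in>grid r. C \<alpha> J * C \<beta> J))"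
    by (simp add: sum.distrib sum_distrib_left) (rule sum.swap)
  also have "(\<Sum>J\<in>grid r. C 0 J * C \<beta> J) = (if \<beta> = 0 then c else 0)"
    by (subst orth) (auto simp: h0)
  also have "(\<Sum>\<alpha>\<in>multi_indices r - {0}. 2 ^ hamming \<alpha> * g \<alpha> * (\<Sum>J\<in>grid r. C \<alpha> J * C \<beta> J))
      = (\<Sum>\<alpha>\<in>multi_indices r - {0}. if \<alpha> = \<beta> then c * g \<beta> else 0)"
    by (intro sum.cong refl) (auto simp: orth)
  also have "\<dots> = (if \<beta> = 0 then 0 else c * g \<beta>)"
    using assms by (simp add: sum.delta')
  finally show ?thesis by (auto simp: C_def c_def)
qed

lemma feasible_coeff_bound:
  fixes g :: "nat ^ 'n::finite \<Rightarrow> real"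
  assumes f: "feasible r g M" and \<beta>: "\<beta> \<in> multi_indices r - {0}"
  shows "\<bar>g \<beta>\<bar> \<le> 1"
proof -
  define C where "C J = (\<Prod>i\<in>UNIV. cos (real (\<beta> $ i) * grid_pt r J $ i))" for J
  define c where "c = real (card (grid r :: ('n \<Rightarrow> nat) set))"
  have c: "c > 0" using card_grid_pos by (simp add: c_def)
  have pos: "trig_kernel r g \<phi> \<ge> 0" for \<phi>
  proof -
    have "trig_kernel r g \<phi> = Re (quad_form (multi_indices r) M (exp_vec \<phi>))"
      using f by (metis feasible_def Re_complex_of_real)
    then show ?thesis using f by (simp add: feasible_def hermitian_psd_def)
  qed
  have C1: "\<bar>C J\<bar> \<le> 1" for J
    unfolding C_def abs_prod by (intro prod_le_1) auto
  have "\<bar>c * g \<beta>\<bar> = \<bar>\<Sum>J\<in>grid r. trig_kernel r g (grid_pt r J) * C J\<bar>"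
    using sum_grid_trig_kernel[of \<beta> r g] \<beta> by (simp add: C_def c_def)
  also have "\<dots> \<le> (\<Sum>J\<in>grid r. \<bar>trig_kernel r g (grid_pt r J) * C J\<bar>)"
    by (rule sum_abs)
  also have "\<dots> \<le> (\<Sum>J\<in>grid r. trig_kernel r g (grid_pt r J))"
    by (intro sum_mono) (use C1 pos in \<open>auto simp: abs_mult intro: mult_left_le\<close>)
  also have "\<dots> = c"
    using sum_grid_trig_kernel[of 0 r g] by (simp add: c_def)
  finally show ?thesis using c by (simp add: abs_mult)
qed

lemma feasible_trace:
  fixes g :: "nat ^ 'n::finite \<Rightarrow> real"
  assumes f: "feasible r g M"
  shows "(\<Sum>\<alpha>\<in>multi_indices r. M \<alpha> \<alpha>) = 1"
proof -
  let ?I = "multi_indices r :: (nat ^ 'n) set"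
  define c where "c = card (grid r :: ('n \<Rightarrow> nat) set)"
  have c: "c > 0" using card_grid_pos by (simp add: c_def)
  define E where "E J \<alpha> = exp_vec (grid_pt r J) \<alpha>" for J and \<alpha> :: "nat ^ 'n"
  have "of_nat c = complex_of_real (\<Sum>J\<in>grid r. trig_kernel r g (grid_pt r J))"
    using sum_grid_trig_kernel[of 0 r g] by (simp add: c_def)
  also have "\<dots> = (\<Sum>J\<in>grid r. quad_form ?I M (E J))"
    using f by (simp add: feasible_def E_def[abs_def])
  also have "\<dots> = (\<Sum>J\<in>grid r. \<Sum>\<alpha>\<in>?I. \<Sum>\<beta>\<in>?I. M \<alpha> \<beta> * (cnj (E J \<alpha>) * E J \<beta>))"
    by (simp add: quad_form_def mult_ac)
  also have "\<dots> = (\<Sum>\<alpha>\<in>?I. \<Sum>\<beta>\<in>?I. M \<alpha> \<beta> * (\<Sum>J\<in>grid r. cnj (E J \<alpha>) * E J \<beta>))"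
    unfolding sum_distrib_left
    by (subst sum.swap) (intro sum.cong refl, subst sum.swap, rule refl)
  also have "\<dots> = (\<Sum>\<alpha>\<in>?I. \<Sum>\<beta>\<in>?I. if \<alpha> = \<beta> then of_nat c * M \<alpha> \<alpha> else 0)"
    by (intro sum.cong refl) (auto simp: E_def sum_grid_exp_vec c_def)
  also have "\<dots> = of_nat c * (\<Sum>\<alpha>\<in>?I. M \<alpha> \<alpha>)"
    by (simp add: sum_distrib_left)
  finally show ?thesis using c by simp
qed

lemma quad_form_two:
  assumes "finite I" "\<alpha> \<in> I" "\<beta> \<in> I" "\<alpha> \<noteq> \<beta>"
  shows "quad_form I M (\<lambda>\<gamma>. if \<gamma> = \<alpha> then a else if \<gamma> = \<beta> then b else 0)
       = cnj a * M \<alpha> \<alpha> * a + cnj a * M \<alpha> \<beta> * b + cnj b * M \<beta> \<alpha> * a + cnj b * M \<beta> \<beta> * b"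
proof -
  let ?x = "\<lambda>\<gamma>. if \<gamma> = \<alpha> then a else if \<gamma> = \<beta> then b else 0"
  have two: "(\<Sum>\<gamma>\<in>I. f \<gamma>) = f \<alpha> + f \<beta>" if "\<And>\<gamma>. \<gamma> \<noteq> \<alpha> \<Longrightarrow> \<gamma> \<noteq> \<beta> \<Longrightarrow> f \<gamma> = 0" for f :: "'a \<Rightarrow> complex"
  proof -
    have "(\<Sum>\<gamma>\<in>I. f \<gamma>) = (\<Sum>\<gamma>\<in>{\<alpha>, \<beta>}. f \<gamma>)"
      using assms that by (intro sum.mono_neutral_right) auto
    then show ?thesis using assms by simp
  qed
  have "quad_form I M ?x = (\<Sum>\<gamma>\<in>I. cnj (?x \<gamma>) * M \<gamma> \<alpha> * ?x \<alpha> + cnj (?x \<gamma>) * M \<gamma> \<beta> * ?x \<beta>)"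
    unfolding quad_form_def by (intro sum.cong refl two) auto
  also have "\<dots> = (cnj (?x \<alpha>) * M \<alpha> \<alpha> * ?x \<alpha> + cnj (?x \<alpha>) * M \<alpha> \<beta> * ?x \<beta>)
      + (cnj (?x \<beta>) * M \<beta> \<alpha> * ?x \<alpha> + cnj (?x \<beta>) * M \<beta> \<beta> * ?x \<beta>)"
    by (rule two) auto
  finally show ?thesis using assms(4) by (simp add: add.assoc)
qed

lemma feasible_entry_bound:
  fixes g :: "nat ^ 'n::finite \<Rightarrow> real"
  assumes f: "feasible r g M" and \<alpha>: "\<alpha> \<in> multi_indices r" and \<beta>: "\<beta> \<in> multi_indices r"
  shows "norm (M \<alpha> \<beta>) \<le> 1"
proof -
  let ?I = "multi_indices r :: (nat ^ 'n) set"
  have herm: "M \<delta> \<gamma> = cnj (M \<gamma> \<delta>)" if "\<gamma> \<in> ?I" "\<delta> \<in> ?I" for \<gamma> \<delta>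
    using f that unfolding feasible_def hermitian_psd_def by blast
  have psd: "Re (quad_form ?I M x) \<ge> 0" for x
    using f by (auto simp: feasible_def hermitian_psd_def)
  have d0: "Re (M \<gamma> \<gamma>) \<ge> 0" if "\<gamma> \<in> ?I" for \<gamma>
  proof -
    have "quad_form ?I M (\<lambda>\<delta>. if \<delta> = \<gamma> then 1 else 0)
        = (\<Sum>\<delta>\<in>?I. if \<delta> = \<gamma> then (\<Sum>\<epsilon>\<in>?I. if \<epsilon> = \<gamma> then M \<gamma> \<gamma> else 0) else 0)"
      unfolding quad_form_def by (intro sum.cong refl) (simp add: that if_distrib cong: if_cong)
    then have "quad_form ?I M (\<lambda>\<delta>. if \<delta> = \<gamma> then 1 else 0) = M \<gamma> \<gamma>"
      using that by simp
    then show ?thesis using psd by metis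
  qed
  have tr: "(\<Sum>\<gamma>\<in>?I. Re (M \<gamma> \<gamma>)) = 1"
    using feasible_trace[OF f] by (metis Re_sum one_complex.sel(1))
  have d1: "Re (M \<gamma> \<gamma>) \<le> 1" if "\<gamma> \<in> ?I" for \<gamma>
    using member_le_sum[of \<gamma> ?I "\<lambda>\<gamma>. Re (M \<gamma> \<gamma>)"] d0 that tr by auto
  show ?thesis
  proof (cases "\<alpha> = \<beta>")
    case True
    have "Im (M \<alpha> \<alpha>) = 0"
      using herm[OF \<alpha> \<alpha>] by (metis Reals_cnj_iff complex_is_Real_iff)
    then have "norm (M \<alpha> \<alpha>) = \<bar>Re (M \<alpha> \<alpha>)\<bar>"
      by (simp add: cmod_eq_Re)
    then show ?thesis
      using True d0[OF \<alpha>] d1[OF \<alpha>] by simp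
  next
    case False
    define m where "m = M \<alpha> \<beta>"
    define u where "u = - cnj (sgn m)"
    have mu: "m * u = - complex_of_real (norm m)"
      by (cases "m = 0")
        (auto simp: u_def sgn_div_norm scaleR_conv_of_real complex_norm_square[symmetric]
          power2_eq_square field_simps)
    have uu: "cnj u * M \<beta> \<beta> * u = complex_of_real ((norm u)\<^sup>2) * M \<beta> \<beta>"
      by (simp only: complex_norm_square mult_ac)
    have nu: "(norm u)\<^sup>2 \<le> 1"
      by (auto simp: u_def norm_sgn)
    have "quad_form ?I M (\<lambda>\<gamma>. if \<gamma> = \<alpha> then 1 else if \<gamma> = \<beta> then u else 0)
        = M \<alpha> \<alpha> + m * u + cnj (m * u) + complex_of_real ((norm u)\<^sup>2) * M \<beta> \<beta>"
      using quad_form_two[OF finite_multi_indices \<alpha> \<beta> False, of M 1 u] herm[OF \<alpha> \<beta>] uu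
      by (simp add: m_def mult_ac)
    then have "0 \<le> Re (M \<alpha> \<alpha>) - 2 * norm m + (norm u)\<^sup>2 * Re (M \<beta> \<beta>)"
      using psd[of "\<lambda>\<gamma>. if \<gamma> = \<alpha> then 1 else if \<gamma> = \<beta> then u else 0"]
      unfolding mu by simp
    moreover have "(norm u)\<^sup>2 * Re (M \<beta> \<beta>) \<le> 1 * 1"
      using nu d0[OF \<beta>] d1[OF \<beta>] by (intro mult_mono) auto
    ultimately show ?thesis
      using d1[OF \<alpha>] by (simp add: m_def)
  qed
qed

subsubsection \<open>Compactness\<close>

lemma compact_functions:
  assumes "compact S"
  shows "compact {f :: 'a \<Rightarrow> 'b::topological_space. \<forall>x. f x \<in> S}"
proof -
  have "compactin (product_topology (\<lambda>_::'a. euclidean) UNIV) (PiE UNIV (\<lambda>_. S))"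
    using assms by (simp add: compactin_PiE)
  moreover have "PiE UNIV (\<lambda>_. S) = {f :: 'a \<Rightarrow> 'b. \<forall>x. f x \<in> S}"
    by auto
  ultimately show ?thesis
    by (simp add: euclidean_product_topology)
qed

lemma continuous_on_entry [continuous_intros]:
  "continuous_on UNIV (\<lambda>p :: ('a \<Rightarrow> real) \<times> ('a \<Rightarrow> 'a \<Rightarrow> complex). snd p \<alpha> \<beta>)"
proof -
  have "continuous_on UNIV (\<lambda>p :: ('a \<Rightarrow> real) \<times> ('a \<Rightarrow> 'a \<Rightarrow> complex). snd p \<alpha>)"
    by (rule continuous_on_product_then_coordinatewise[OF continuous_on_snd[OF continuous_on_id]])
  then show ?thesis
    by (rule continuous_on_product_then_coordinatewise)
qed

lemma continuous_on_coeff [continuous_intros]: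
  "continuous_on UNIV (\<lambda>p :: ('a \<Rightarrow> real) \<times> ('a \<Rightarrow> 'a \<Rightarrow> complex). fst p \<alpha>)"
  by (rule continuous_on_product_then_coordinatewise[OF continuous_on_fst[OF continuous_on_id]])

lemma closed_feasible:
  "closed {p :: (nat ^ 'n::finite \<Rightarrow> real) \<times> _. feasible r (fst p) (snd p)}"
proof -
  let ?I = "multi_indices r :: (nat ^ 'n) set"
  let ?P = "UNIV :: ((nat ^ 'n \<Rightarrow> real) \<times> (nat ^ 'n \<Rightarrow> nat ^ 'n \<Rightarrow> complex)) set"
  have q: "continuous_on ?P (\<lambda>p. quad_form ?I (snd p) x)" for x
    unfolding quad_form_def
    by (intro continuous_on_sum continuous_on_mult continuous_on_const continuous_on_entry)
  have k: "continuous_on ?P (\<lambda>p. trig_kernel r (fst p) \<phi>)" for \<phi>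
    unfolding trig_kernel_def
    by (intro continuous_on_add continuous_on_sum continuous_on_mult continuous_on_const
        continuous_on_coeff)
  have "{p \<in> ?P. feasible r (fst p) (snd p)}
      = (\<Inter>\<alpha>\<in>?I. \<Inter>\<beta>\<in>?I. {p. snd p \<beta> \<alpha> = cnj (snd p \<alpha> \<beta>)})
        \<inter> (\<Inter>x. {p. 0 \<le> Re (quad_form ?I (snd p) x)})
        \<inter> (\<Inter>\<phi>. {p. complex_of_real (trig_kernel r (fst p) \<phi>)
                   = quad_form ?I (snd p) (exp_vec \<phi>)})"
    by (auto simp: feasible_def hermitian_psd_def)
  also have "closed \<dots>"
    by (intro closed_Int closed_INT ballI closed_Collect_eq closed_Collect_le
        continuous_on_cnj continuous_on_Re continuous_on_of_real continuous_on_const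
        continuous_on_entry q k)
  finally show ?thesis by simp
qed

theorem sigma_sq_attained:
  assumes r: "r \<ge> 1"
  shows "\<exists>(g :: nat ^ 'n::finite \<Rightarrow> real) M.
           feasible r g M \<and> objective g = sigma_sq TYPE('n) r \<and>
           (\<forall>(g' :: nat ^ 'n \<Rightarrow> real) M'. feasible r g' M' \<longrightarrow> objective g \<le> objective g')"
proof -
  let ?I = "multi_indices r :: (nat ^ 'n) set"
  define S :: "((nat ^ 'n \<Rightarrow> real) \<times> (nat ^ 'n \<Rightarrow> nat ^ 'n \<Rightarrow> complex)) set"
    where "S = ({g. \<forall>\<alpha>. g \<alpha> \<in> {-1..1}} \<times> {M. \<forall>\<alpha>. M \<alpha> \<in> {h. \<forall>\<beta>. h \<beta> \<in> cball 0 1}})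
      \<inter> {p. feasible r (fst p) (snd p)}"
  have compact: "compact S"
    unfolding S_def
    by (intro compact_Int_closed compact_Times compact_functions closed_feasible) auto
  have trunc: "\<exists>p\<in>S. objective (fst p) = objective g"
    if f: "feasible r g M" for g :: "nat ^ 'n \<Rightarrow> real" and M
  proof -
    define g' where "g' \<alpha> = (if \<alpha> \<in> ?I - {0} then g \<alpha> else 0)" for \<alpha>
    define M' where "M' \<alpha> \<beta> = (if \<alpha> \<in> ?I \<and> \<beta> \<in> ?I then M \<alpha> \<beta> else 0)" for \<alpha> \<beta>
    have q: "quad_form ?I M' x = quad_form ?I M x" for x
      unfolding quad_form_def by (intro sum.cong refl) (auto simp: M'_def)
    have k: "trig_kernel r g' \<phi> = trig_kernel r g \<phi>" for \<phi>
      unfolding trig_kernel_def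
      by (intro arg_cong2[of _ _ _ _ "(+)"] sum.cong refl) (auto simp: g'_def)
    have herm: "M \<beta> \<alpha> = cnj (M \<alpha> \<beta>)" if "\<alpha> \<in> ?I" "\<beta> \<in> ?I" for \<alpha> \<beta>
      using f that unfolding feasible_def hermitian_psd_def by blast
    have "M' \<beta> \<alpha> = cnj (M' \<alpha> \<beta>)" if "\<alpha> \<in> ?I" "\<beta> \<in> ?I" for \<alpha> \<beta>
      unfolding M'_def by (simp only: that simp_thms if_True) (rule herm[OF that])
    then have "feasible r g' M'"
      using f unfolding feasible_def hermitian_psd_def q k by blast
    moreover have "g' \<alpha> \<in> {-1..1}" for \<alpha>
      using feasible_coeff_bound[OF f, of \<alpha>] by (auto simp: g'_def abs_le_iff)
    moreover have "M' \<alpha> \<beta> \<in> cball 0 1" for \<alpha> \<beta>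
      using feasible_entry_bound[OF f, of \<alpha> \<beta>] by (auto simp: M'_def)
    ultimately have "(g', M') \<in> S"
      unfolding S_def by auto
    moreover have "objective g' = objective g"
      unfolding objective_def g'_def using axis_in_multi_indices[OF r] by (intro sum.cong) auto
    ultimately show ?thesis by force
  qed
  have "S \<noteq> {}"
    using trunc[OF feasible_trivial] by auto
  moreover have "continuous_on S (\<lambda>p. objective (fst p))"
    unfolding objective_def
    by (rule continuous_on_subset[OF _ subset_UNIV]) (intro continuous_intros)
  ultimately obtain p where p: "p \<in> S" "\<And>q. q \<in> S \<Longrightarrow> objective (fst p) \<le> objective (fst q)"
    using continuous_attains_inf[OF compact] by blast
  have f: "feasible r (fst p) (snd p)"
    using p(1) by (simp add: S_def)
  have min: "objective (fst p) \<le> objective g'" if "feasible r g' M'"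
    for g' :: "nat ^ 'n \<Rightarrow> real" and M'
    using trunc[OF that] p(2) by metis
  have "sigma_sq TYPE('n) r = objective (fst p)"
    unfolding sigma_sq_def by (rule cInf_eq_minimum) (use f min in auto)
  with f min show ?thesis by metis
qed

end

theory Submission
  imports Defs "HOL-Real_Asymp.Real_Asymp"
begin

text \<open>
  With \<open>k = \<lfloor>r / n\<rfloor>\<close>, the product of \<open>n\<close> copies of a univariate kernel
  $|\sum_{j \le k} p_j e^{\imath j \phi}|^2 = 1 + 2 \sum_{1 \le j \le k} c_j \cos (j\phi)$ is a
  feasible point with \<open>g\<^sub>\<alpha> = \<Prod>\<^sub>i c\<^bsub>\<alpha>\<^sub>i\<^esub>\<close>, where the rank-one matrix \<open>M\<close> has entries
  \<open>w\<^sub>\<alpha> w\<^sub>\<beta>\<close> with \<open>w\<^sub>\<alpha> = \<Prod>\<^sub>i p\<^bsub>\<alpha>\<^sub>i\<^esub>\<close>. Fejer's choice, \<open>p\<^sub>j\<close> proportional to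
  $\sin ((j+1)\pi/(k+2))$, gives $c_1 = \cos(\pi/(k+2))$, and \<open>k + 2 > (r + n) / n\<close>.
\<close>

section \<open>Univariate kernels: squared moduli of trigonometric polynomials\<close>

text \<open>For \<open>p\<close> vanishing beyond \<open>k\<close>, this is the coefficient of
  frequency \<open>j\<close> in the squared modulus of the trigonometric polynomial with
  coefficients \<open>p\<close>. Letting \<open>l\<close> run up to \<open>k\<close> instead of
  \<open>k - j\<close> only adds zero terms then.\<close>

definition autocorr :: "nat \<Rightarrow> (nat \<Rightarrow> real) \<Rightarrow> nat \<Rightarrow> real" where
  "autocorr k p j = (\<Sum>l\<le>k. p l * p (l + j))"

lemma autocorr_eq_0:
  assumes "\<And>j. j > k \<Longrightarrow> p j = 0" "j > k"
  shows "autocorr k p j = 0"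
  using assms by (simp add: autocorr_def)

text \<open>Folding along the diagonal: by symmetry the terms below it double those above it, and
  these are indexed by the offset \<open>j = m - l\<close>.\<close>

lemma sum_sum_symmetric:
  fixes h :: "nat \<Rightarrow> nat \<Rightarrow> real"
  assumes sym: "\<And>l m. h l m = h m l"
    and vanish: "\<And>l m. m > k \<Longrightarrow> h l m = 0"
  shows "(\<Sum>l\<le>k. \<Sum>m\<le>k. h l m) = (\<Sum>l\<le>k. \<Sum>j\<le>k. (if j = 0 then 1 else 2) * h l (l + j))"
proof -
  have swap: "(\<Sum>l\<le>k. \<Sum>m\<le>k. if m < l then h l m else 0)
      = (\<Sum>l\<le>k. \<Sum>m\<le>k. if l < m then h l m else 0)"
    by (subst sum.swap) (intro sum.cong refl, simp add: sym)
  have "(\<Sum>l\<le>k. \<Sum>m\<le>k. h l m) = (\<Sum>l\<le>k. \<Sum>m\<le>k. (if l \<le> m then h l m else 0)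
      + (if m < l then h l m else 0))"
    by (intro sum.cong) auto
  also have "\<dots> = (\<Sum>l\<le>k. \<Sum>m\<le>k. (if l \<le> m then h l m else 0) + (if l < m then h l m else 0))"
    by (simp only: sum.distrib swap)
  also have "\<dots> = (\<Sum>l\<le>k. \<Sum>m\<in>{l..k}. (if m = l then 1 else 2) * h l m)"
    by (intro sum.cong sum.mono_neutral_cong_right refl) auto
  also have "\<dots> = (\<Sum>l\<le>k. \<Sum>j\<le>k. (if j = 0 then 1 else 2) * h l (l + j))"
  proof (rule sum.cong[OF refl])
    fix l assume "l \<in> {..k}"
    then have "(\<Sum>m\<in>{l..k}. (if m = l then 1 else 2) * h l m)
        = (\<Sum>j\<le>k - l. (if j = 0 then 1 else 2) * h l (l + j))"
      by (intro sum.reindex_bij_witness[of _ "\<lambda>j. l + j" "\<lambda>m. m - l"]) auto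
    \<comment> \<open>The offsets added here have \<open>l + j > k\<close>, where \<open>h\<close>
      vanishes.\<close>
    also have "\<dots> = (\<Sum>j\<le>k. (if j = 0 then 1 else 2) * h l (l + j))"
      by (intro sum.mono_neutral_left) (auto intro!: vanish)
    finally show "(\<Sum>m\<in>{l..k}. (if m = l then 1 else 2) * h l m)
        = (\<Sum>j\<le>k. (if j = 0 then 1 else 2) * h l (l + j))" .
  qed
  finally show ?thesis .
qed

text \<open>The squares of real and imaginary part combine, by the addition theorem, into cosines of
  differences of frequencies; equal differences are then collected.\<close>

lemma norm_trig_poly_squared:
  assumes vanish: "\<And>j. j > k \<Longrightarrow> p j = 0"
  shows "(norm (\<Sum>j\<le>k. complex_of_real (p j) * cis (real j * t)))\<^sup>2
       = (\<Sum>j\<le>k. (if j = 0 then 1 else 2) * autocorr k p j * cos (real j * t))"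
proof -
  have "(norm (\<Sum>j\<le>k. complex_of_real (p j) * cis (real j * t)))\<^sup>2
      = (\<Sum>j\<le>k. p j * cos (real j * t))\<^sup>2 + (\<Sum>j\<le>k. p j * sin (real j * t))\<^sup>2"
    by (simp add: cmod_power2)
  also have "\<dots> = (\<Sum>l\<le>k. \<Sum>m\<le>k. p l * p m * cos (real m * t - real l * t))"
    by (simp add: power2_eq_square sum_product sum.distrib[symmetric] cos_diff algebra_simps)
  also have "\<dots> = (\<Sum>l\<le>k. \<Sum>j\<le>k. (if j = 0 then 1 else 2)
      * (p l * p (l + j) * cos (real (l + j) * t - real l * t)))"
  proof (rule sum_sum_symmetric)
    show "p l * p m * cos (real m * t - real l * t) = p m * p l * cos (real l * t - real m * t)"
      for l m
      using cos_minus[of "real m * t - real l * t"] by simp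
  qed (simp add: vanish)
  also have "\<dots> = (\<Sum>l\<le>k. \<Sum>j\<le>k. (if j = 0 then 1 else 2) * cos (real j * t) * (p l * p (l + j)))"
    by (intro sum.cong refl) (simp add: algebra_simps)
  also have "\<dots> = (\<Sum>j\<le>k. (if j = 0 then 1 else 2) * autocorr k p j * cos (real j * t))"
    by (subst sum.swap) (simp add: autocorr_def sum_distrib_left sum_distrib_right mult_ac)
  finally show ?thesis .
qed

section \<open>Product kernels as feasible points\<close>

text \<open>The simplex of multi-indices contains the box with side \<open>k\<close>. Outside the
  box some factor is zero; over the box the sum factors by distributivity.\<close>

lemma sum_multi_indices_prod:
  fixes f :: "'n::finite \<Rightarrow> nat \<Rightarrow> 'b::comm_semiring_1"
  assumes vanish: "\<And>i j. j > k \<Longrightarrow> f i j = 0" and k: "CARD('n) * k \<le> r"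
  shows "(\<Sum>\<alpha>\<in>multi_indices r. \<Prod>i\<in>UNIV. f i (\<alpha> $ i)) = (\<Prod>i\<in>UNIV. \<Sum>j\<le>k. f i j)"
proof -
  let ?B = "{\<alpha> :: nat ^ 'n. \<forall>i. \<alpha> $ i \<le> k}"
  have "?B \<subseteq> multi_indices r"
  proof
    fix \<alpha> assume "\<alpha> \<in> ?B"
    then have "(\<Sum>i\<in>UNIV. \<alpha> $ i) \<le> CARD('n) * k"
      using sum_bounded_above[of UNIV "\<lambda>i. \<alpha> $ i" k] by simp
    then show "\<alpha> \<in> multi_indices r"
      using k by (simp add: multi_indices_def)
  qed
  then have "(\<Sum>\<alpha>\<in>multi_indices r. \<Prod>i\<in>UNIV. f i (\<alpha> $ i)) = (\<Sum>\<alpha>\<in>?B. \<Prod>i\<in>UNIV. f i (\<alpha> $ i))"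
    by (intro sum.mono_neutral_right finite_multi_indices ballI prod_zero)
       (auto simp: not_le intro: vanish)
  also have "\<dots> = (\<Sum>J\<in>PiE UNIV (\<lambda>_. {..k}). \<Prod>i\<in>UNIV. f i (J i))"
    by (intro sum.reindex_bij_witness[of _ vec_lambda vec_nth]) auto
  also have "\<dots> = (\<Prod>i\<in>UNIV. \<Sum>j\<le>k. f i j)"
    by (subst prod_sum_PiE) auto
  finally show ?thesis .
qed

lemma two_power_hamming:
  "2 ^ hamming \<alpha> = (\<Prod>i\<in>UNIV. if \<alpha> $ i = 0 then 1 else 2 :: real)" for \<alpha> :: "nat ^ 'n::finite"
  by (simp add: prod.If_cases hamming_def Collect_neg_eq[symmetric])

lemma exp_vec_eq_prod: "exp_vec \<phi> \<alpha> = (\<Prod>i\<in>UNIV. cis (real (\<alpha> $ i) * \<phi> $ i))"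
  by (simp add: exp_vec_def cis_conv_exp exp_sum sum_distrib_left)

text \<open>Yields both the kernel identity and positive semidefiniteness of the rank-one
  matrix.\<close>

lemma quad_form_rank_one:
  "quad_form I (\<lambda>\<alpha> \<beta>. complex_of_real (w \<alpha> * w \<beta>)) v
     = complex_of_real ((norm (\<Sum>\<alpha>\<in>I. complex_of_real (w \<alpha>) * v \<alpha>))\<^sup>2)"
proof -
  let ?z = "\<Sum>\<alpha>\<in>I. complex_of_real (w \<alpha>) * v \<alpha>"
  have "quad_form I (\<lambda>\<alpha> \<beta>. complex_of_real (w \<alpha> * w \<beta>)) v = cnj ?z * ?z"
    by (simp only: quad_form_def cnj_sum sum_product) (simp add: mult_ac)
  then show ?thesis
    by (simp only: complex_norm_square mult.commute)
qed

text \<open>Both sides factor over the coordinates; \<open>2 ^ hamming \<alpha>\<close> supplies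
  exactly the factor 2 that each nonzero frequency carries in the univariate expansion.\<close>

lemma feasible_product_kernel:
  fixes p :: "nat \<Rightarrow> real"
  assumes vanish: "\<And>j. j > k \<Longrightarrow> p j = 0" and unit: "autocorr k p 0 = 1"
    and k: "CARD('n::finite) * k \<le> r"
  shows "feasible r (\<lambda>\<alpha> :: nat ^ 'n. \<Prod>i\<in>UNIV. autocorr k p (\<alpha> $ i))
           (\<lambda>\<alpha> \<beta>. complex_of_real ((\<Prod>i\<in>UNIV. p (\<alpha> $ i)) * (\<Prod>i\<in>UNIV. p (\<beta> $ i))))"
    (is "feasible r ?g ?M")
proof -
  let ?I = "multi_indices r :: (nat ^ 'n) set"
  have "complex_of_real (trig_kernel r ?g \<phi>) = quad_form ?I ?M (exp_vec \<phi>)" for \<phi>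
  proof -
    let ?F = "\<lambda>\<alpha>. 2 ^ hamming \<alpha> * ?g \<alpha> * (\<Prod>i\<in>UNIV. cos (real (\<alpha> $ i) * \<phi> $ i))"
    \<comment> \<open>By \<open>unit\<close>, the separate constant 1 of the kernel is the term at
      0.\<close>
    have "trig_kernel r ?g \<phi> = (\<Sum>\<alpha>\<in>?I. ?F \<alpha>)"
      by (subst sum.remove[of _ 0]) (auto simp: trig_kernel_def hamming_def unit)
    also have "\<dots> = (\<Sum>\<alpha>\<in>?I. \<Prod>i\<in>UNIV. (if \<alpha> $ i = 0 then 1 else 2)
        * autocorr k p (\<alpha> $ i) * cos (real (\<alpha> $ i) * \<phi> $ i))"
      by (simp only: two_power_hamming prod.distrib)
    also have "\<dots> = (\<Prod>i\<in>UNIV. \<Sum>j\<le>k. (if j = 0 then 1 else 2)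
        * autocorr k p j * cos (real j * \<phi> $ i))"
      using k by (intro sum_multi_indices_prod) (simp_all add: autocorr_eq_0 vanish)
    also have "\<dots> = (\<Prod>i\<in>UNIV. (norm (\<Sum>j\<le>k. complex_of_real (p j) * cis (real j * \<phi> $ i)))\<^sup>2)"
      by (simp only: norm_trig_poly_squared[OF vanish])
    also have "\<dots> = (norm (\<Prod>i\<in>UNIV. \<Sum>j\<le>k. complex_of_real (p j) * cis (real j * \<phi> $ i)))\<^sup>2"
      by (simp only: prod_norm[symmetric] prod_power_distrib)
    also have "(\<Prod>i\<in>UNIV. \<Sum>j\<le>k. complex_of_real (p j) * cis (real j * \<phi> $ i))
        = (\<Sum>\<alpha>\<in>?I. \<Prod>i\<in>UNIV. complex_of_real (p (\<alpha> $ i)) * cis (real (\<alpha> $ i) * \<phi> $ i))"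
      using k by (intro sum_multi_indices_prod[symmetric]) (simp_all add: vanish)
    also have "\<dots> = (\<Sum>\<alpha>\<in>?I. complex_of_real (\<Prod>i\<in>UNIV. p (\<alpha> $ i)) * exp_vec \<phi> \<alpha>)"
      by (simp add: prod.distrib exp_vec_eq_prod)
    finally show ?thesis
      by (simp only: quad_form_rank_one)
  qed
  moreover have "hermitian_psd ?I ?M"
    unfolding hermitian_psd_def quad_form_rank_one by simp
  ultimately show ?thesis
    by (simp add: feasible_def)
qed

lemma objective_product_kernel:
  assumes "c 0 = 1"
  shows "objective (\<lambda>\<alpha> :: nat ^ 'n::finite. \<Prod>i\<in>UNIV. c (\<alpha> $ i)) = real CARD('n) * (1 - c 1)"
proof -
  have "(\<Prod>j\<in>UNIV. c ((axis i 1 :: nat ^ 'n) $ j)) = c 1" for i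
    by (subst prod.remove[of _ i]) (simp_all add: axis_def assms)
  then show ?thesis
    by (simp add: objective_def)
qed

section \<open>Fejer's coefficients\<close>

text \<open>For a unit vector, \<open>autocorr k p 1\<close> is half the Rayleigh quotient of the
  adjacency matrix of the path on \<open>k + 1\<close> vertices, whose largest eigenvalue is
  \<open>2 * cos (pi / (k + 2))\<close>.\<close>

lemma exists_fejer_coefficients:
  shows "\<exists>p. (\<forall>j > k. p j = 0) \<and> autocorr k p 0 = 1 \<and> autocorr k p 1 = cos (pi / real (k + 2))"
proof -
  define \<theta> where "\<theta> = pi / real (k + 2)"
  define q where "q j = (if j \<le> k then sin (real (j + 1) * \<theta>) else 0)" for j
  define S where "S = (\<Sum>j\<le>k. (q j)\<^sup>2)"
  have sin_end: "sin (real (k + 2) * \<theta>) = 0"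
    by (simp add: \<theta>_def)
  have "0 < \<theta>" "\<theta> < pi"
    by (simp_all add: \<theta>_def field_simps add_pos_nonneg)
  then have "0 < (q 0)\<^sup>2"
    using sin_gt_zero[of \<theta>] by (simp add: q_def)
  also have "\<dots> \<le> S"
    unfolding S_def by (rule member_le_sum) auto
  finally have S: "S > 0" .
  \<comment> \<open>The sequence \<open>sin (j\<theta>)\<close> is an eigenvector of the path: its neighbours add up to \<open>2 cos \<theta>\<close>
    times itself, and it vanishes at both ends.\<close>
  have q: "q j = sin (real (j + 1) * \<theta>)" if "j \<le> k + 1" for j
    using that sin_end by (cases "j = k + 1") (auto simp: q_def)
  have step: "q (j + 1) + sin (real j * \<theta>) = 2 * cos \<theta> * q j" if "j \<le> k" for j
    using that sin_add[of "real (j + 1) * \<theta>" \<theta>] sin_diff[of "real (j + 1) * \<theta>" \<theta>]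
    by (simp add: q algebra_simps)
  \<comment> \<open>The index shift costs nothing: the term gained at \<open>k + 1\<close> has
    \<open>q (k + 1) = 0\<close>, the term lost at 0 has \<open>sin 0 = 0\<close>.\<close>
  have shift: "(\<Sum>j\<le>k. q j * sin (real j * \<theta>)) = (\<Sum>j\<le>k. q j * q (j + 1))"
  proof -
    have "(\<Sum>j\<le>k. q j * sin (real j * \<theta>)) = (\<Sum>j\<le>Suc k. q j * sin (real j * \<theta>))"
      by (simp add: q_def)
    also have "\<dots> = (\<Sum>j\<le>k. q (j + 1) * sin (real (j + 1) * \<theta>))"
      by (subst sum.atMost_Suc_shift) simp
    also have "\<dots> = (\<Sum>j\<le>k. q j * q (j + 1))"
      by (intro sum.cong) (auto simp: q)
    finally show ?thesis .
  qed
  have "2 * (\<Sum>j\<le>k. q j * q (j + 1)) = (\<Sum>j\<le>k. q j * (q (j + 1) + sin (real j * \<theta>)))"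
    by (simp only: distrib_left sum.distrib shift)
  also have "\<dots> = (\<Sum>j\<le>k. 2 * cos \<theta> * (q j)\<^sup>2)"
    by (intro sum.cong refl) (subst step, simp_all add: power2_eq_square)
  also have "\<dots> = 2 * cos \<theta> * S"
    by (simp add: S_def sum_distrib_left)
  finally have corr: "(\<Sum>j\<le>k. q j * q (j + 1)) = cos \<theta> * S"
    by simp
  define p where "p j = q j / sqrt S" for j
  have p: "autocorr k p j = (\<Sum>l\<le>k. q l * q (l + j)) / S" for j
    using S by (simp add: autocorr_def p_def sum_divide_distrib)
  have "autocorr k p 0 = 1"
    using S by (simp add: p S_def power2_eq_square)
  moreover have "autocorr k p 1 = cos \<theta>"
    unfolding p corr using S by simp
  moreover have "\<forall>j > k. p j = 0"
    by (simp add: p_def q_def)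
  ultimately show ?thesis
    unfolding \<theta>_def by blast
qed

section \<open>The bound and its asymptotics\<close>

lemma sigma_sq_le:
  assumes "r \<ge> CARD('n::finite)"
  shows "sigma_sq TYPE('n) r
       \<le> real CARD('n) * (1 - cos (real CARD('n) * pi / (real r + real CARD('n))))"
proof -
  let ?n = "CARD('n)"
  define k where "k = r div ?n"
  obtain p where p: "\<And>j. j > k \<Longrightarrow> p j = 0" "autocorr k p 0 = 1"
      "autocorr k p 1 = cos (pi / real (k + 2))"
    using exists_fejer_coefficients by blast
  have n: "?n > 0" by simp
  have "?n * k \<le> r"
    by (simp add: k_def)
  note feasible_product_kernel[OF p(1,2) this]
  moreover have "r \<ge> 1"
    using assms n by linarith
  ultimately have "sigma_sq TYPE('n) r \<le> objective (\<lambda>\<alpha> :: nat ^ 'n. \<Prod>i\<in>UNIV. autocorr k p (\<alpha> $ i))"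
    using sigma_sq_attained[where 'n = 'n] by metis
  also have "\<dots> = real ?n * (1 - cos (pi / real (k + 2)))"
    using objective_product_kernel[of "autocorr k p", where 'n = 'n] p by simp
  also have "\<dots> \<le> real ?n * (1 - cos (real ?n * pi / (real r + real ?n)))"
  proof -
    \<comment> \<open>Rounding \<open>r / n\<close> down loses less than 1, so the denominator
      \<open>k + 2\<close> still exceeds \<open>r / n + 1\<close>.\<close>
    have "r < ?n * (k + 1)"
      unfolding k_def using dividend_less_times_div[OF n, of r] by simp
    then have "r + ?n \<le> ?n * (k + 2)"
      by simp
    then have "real r + real ?n \<le> real ?n * real (k + 2)"
      by (metis of_nat_add of_nat_le_iff of_nat_mult)
    then have "real ?n * pi / (real ?n * real (k + 2)) \<le> real ?n * pi / (real r + real ?n)"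
      using n by (intro divide_left_mono mult_pos_pos add_nonneg_pos) auto
    then have "pi / real (k + 2) \<le> real ?n * pi / (real r + real ?n)"
      using n by simp
    \<comment> \<open>Keeps both angles in the interval from 0 to \<open>pi\<close>, where cosine
      decreases.\<close>
    moreover have "real ?n * pi / (real r + real ?n) \<le> pi"
      using n by (simp add: pos_divide_le_eq add_nonneg_pos algebra_simps)
    ultimately have "cos (real ?n * pi / (real r + real ?n)) \<le> cos (pi / real (k + 2))"
      by (intro cos_monotone_0_pi_le) auto
    then show ?thesis
      by (intro mult_left_mono) auto
  qed
  finally show ?thesis .
qed

text \<open>The angle tends to 0 without being 0, as \<open>c > 0\<close>, so the expansion of
  \<open>1 - cos x\<close> as \<open>x^2 / 2\<close> near 0 can be composed with it.\<close>

lemma bound_asymp_equiv: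
  fixes c :: real
  assumes "c > 0"
  shows "(\<lambda>r::nat. c * (1 - cos (c * pi / (real r + c))))
           \<sim>[at_top] (\<lambda>r. c ^ 3 * pi ^ 2 / (2 * (real r + c) ^ 2))"
proof -
  have "filterlim (\<lambda>r::nat. c * pi / (real r + c)) (at 0) at_top"
    using assms by real_asymp
  moreover have "(\<lambda>x. c * (1 - cos x)) \<sim>[at 0] (\<lambda>x. c * x\<^sup>2 / 2)"
    using assms by real_asymp
  ultimately have "(\<lambda>r::nat. c * (1 - cos (c * pi / (real r + c))))
      \<sim>[at_top] (\<lambda>r. c * (c * pi / (real r + c))\<^sup>2 / 2)"
    by (rule asymp_equiv_compose'[rotated])
  then show ?thesis
    by (simp add: power_divide power_mult_distrib power3_eq_cube power2_eq_square mult_ac)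
qed

theorem proposition2:
  shows "(\<forall>r \<ge> CARD('n::finite).
            sigma_sq TYPE('n) r
              \<le> real CARD('n) * (1 - cos (real CARD('n) * pi / (real r + real CARD('n)))))
       \<and> (\<lambda>r::nat. real CARD('n) * (1 - cos (real CARD('n) * pi / (real r + real CARD('n)))))
            \<sim>[at_top]
         (\<lambda>r::nat. real CARD('n) ^ 3 * pi ^ 2 / (2 * (real r + real CARD('n)) ^ 2))"
  using sigma_sq_le[where 'n = 'n] bound_asymp_equiv[of "real CARD('n)"] by simp

end
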